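(* Let $t,f,d$ be integers with $0\le f,d\le t$ and $f\ne d$, and let $a>1$ be an integer such that $a\mid f$, $a\nmid d$, $a\nmid t$, $t>2a$, and $\lfloor \frac{t}{a}\rfloor-\lceil \frac{d}{a}\rceil>\frac{f}{a}$. Then an optimal indiscreet weighing strategy $\mathcal{A}$ for the parameters $t,f,d$ satisfies $$\binom{\lfloor \frac{t}{a}\rfloor-\lceil \frac{d}{a}\rceil}{\frac{f}{a}}^{a\lfloor \frac{t}{a}\rfloor-a\lfloor \frac{d}{a}\rfloor+d+1-t}\ \binom{\lfloor \frac{t}{a}\rfloor-\lfloor \frac{d}{a}\rfloor}{\frac{f}{a}}^{a-a\lfloor \frac{t}{a}\rfloor+a\lfloor \frac{d}{a}\rfloor-d-1+t}\ \le\ |W(\mathbf{s}|Z_f,\mathcal{A})| .$$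
   Context: There are $t$ coins that look identical. Genuine coins all have the same weight $w_1$, and fake coins all have the same weight $w_0<w_1$. A situation is a vector $\mathbf{z}\in\{0,1\}^t$, where $z_i=0$ means that coin $i$ is fake and $z_i=1$ means that it is genuine. For $0\le n\le t$, $Z_n$ is the set of situations with exactly $n$ fake coins, so $|Z_n|=\binom{t}{n}$. The true situation $\mathbf{x}\in Z_f$ is known to the person weighing. An observer knows only that the number of fake coins is $f$ or $d$, and sees the weighings and their results. A weighing is a nonzero vector $\mathbf{h}\in\{-1,0,1\}^t$ with $\sum_i h_i=0$ ($h_i=-1$: coin $i$ on the left pan; $h_i=1$: right pan; $h_i=0$: not weighed). Its result in situation $\mathbf{z}$ is $s(\mathbf{z},\mathbf{h})=\mathrm{sign}(\mathbf{z}\cdot\mathbf{h})\in\{-1,0,1\}$. A weighing strategy $\mathcal{A}$ of length $m$ is a rule producing consecutive weighings $\mathbf{h}^1,\dots,\mathbf{h}^m$, where $\mathbf{h}^1$ is fixed and each later weighing is either fixed in advance or determined by the earlier results. The syndrome of $\mathbf{z}$ is the sequence of results $\mathbf{s}(\mathbf{z}|\mathcal{A})=(s(\mathbf{z},\mathbf{h}^1),\dots,s(\mathbf{z},\mathbf{h}^m))$ when $\mathcal{A}$ is carried out in situation $\mathbf{z}$. For a set $Z$ of situations, $W(\mathbf{s}|Z,\mathcal{A})=\{\mathbf{z}\in Z:\mathbf{s}(\mathbf{z}|\mathcal{A})=\mathbf{s}\}$. Throughout, $\mathbf{s}=\mathbf{s}(\mathbf{x}|\mathcal{A})$ is the syndrome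 actually observed. $\mathcal{A}$ is successful if $|W(\mathbf{s}|Z_d,\mathcal{A})|=0$ and $|W(\mathbf{s}|Z_f,\mathcal{A})|>0$. A successful strategy is discreet if for every $1\le i\le t$ the entry $z_i$ takes both values $0$ and $1$ as $\mathbf{z}$ ranges over $W(\mathbf{s}|Z_f,\mathcal{A})$; otherwise it is indiscreet. An optimal indiscreet strategy is a successful indiscreet strategy with the largest possible value of $|W(\mathbf{s}|Z_f,\mathcal{A})|$ among successful indiscreet strategies for the given $t,f,d$. *)

theory Defs
  imports Complex_Main "HOL-Library.FuncSet"
begin

text \<open>
  Coins are numbered from 1 to t.  Vectors indexed by the coins are extensional functions
  (\<^const>\<open>PiE\<close>), so that cardinalities of sets of vectors are the intended ones.
\<close>

definition situations :: "nat \<Rightarrow> nat \<Rightarrow> (nat \<Rightarrow> int) set" where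
  "situations t n = {z \<in> {1..t} \<rightarrow>\<^sub>E {0, 1}. card {i \<in> {1..t}. z i = 0} = n}"

definition weighings :: "nat \<Rightarrow> (nat \<Rightarrow> int) set" where
  "weighings t =
    {h \<in> {1..t} \<rightarrow>\<^sub>E {-1, 0, 1}. (\<exists>i\<in>{1..t}. h i \<noteq> 0) \<and> (\<Sum>i=1..t. h i) = 0}"

definition result :: "nat \<Rightarrow> (nat \<Rightarrow> int) \<Rightarrow> (nat \<Rightarrow> int) \<Rightarrow> int" where
  "result t z h = sgn (\<Sum>i=1..t. z i * h i)"

text \<open>
  A strategy maps the list of results obtained so far (oldest first) to the next weighing.
  The first weighing is the value at the empty list; a weighing fixed in advance is the case
  where the value depends only on the length of the list.
\<close>

type_synonym strategy = "int list \<Rightarrow> nat \<Rightarrow> int"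

definition weighing_strategy :: "nat \<Rightarrow> nat \<Rightarrow> strategy \<Rightarrow> bool" where
  "weighing_strategy t m A \<longleftrightarrow>
    (\<forall>r. set r \<subseteq> {-1, 0, 1} \<and> length r < m \<longrightarrow> A r \<in> weighings t)"

primrec syndrome :: "nat \<Rightarrow> strategy \<Rightarrow> (nat \<Rightarrow> int) \<Rightarrow> nat \<Rightarrow> int list" where
  "syndrome t A z 0 = []"
| "syndrome t A z (Suc m) = syndrome t A z m @ [result t z (A (syndrome t A z m))]"

definition W :: "nat \<Rightarrow> int list \<Rightarrow> (nat \<Rightarrow> int) set \<Rightarrow> nat \<Rightarrow> strategy \<Rightarrow> (nat \<Rightarrow> int) set" where
  "W t s Z m A = {z \<in> Z. syndrome t A z m = s}"

text \<open>
  The notions below refer to the true situation x, which determines the observed syndrome.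
\<close>

definition successful ::
    "nat \<Rightarrow> nat \<Rightarrow> nat \<Rightarrow> (nat \<Rightarrow> int) \<Rightarrow> nat \<Rightarrow> strategy \<Rightarrow> bool" where
  "successful t f d x m A \<longleftrightarrow>
    weighing_strategy t m A \<and>
    card (W t (syndrome t A x m) (situations t d) m A) = 0 \<and>
    card (W t (syndrome t A x m) (situations t f) m A) > 0"

definition discreet ::
    "nat \<Rightarrow> nat \<Rightarrow> nat \<Rightarrow> (nat \<Rightarrow> int) \<Rightarrow> nat \<Rightarrow> strategy \<Rightarrow> bool" where
  "discreet t f d x m A \<longleftrightarrow>
    successful t f d x m A \<and>
    (\<forall>i\<in>{1..t}. (\<lambda>z. z i) ` W t (syndrome t A x m) (situations t f) m A = {0, 1})"

definition indiscreet ::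
    "nat \<Rightarrow> nat \<Rightarrow> nat \<Rightarrow> (nat \<Rightarrow> int) \<Rightarrow> nat \<Rightarrow> strategy \<Rightarrow> bool" where
  "indiscreet t f d x m A \<longleftrightarrow> successful t f d x m A \<and> \<not> discreet t f d x m A"

text \<open>
  Optimality compares strategies of all lengths for the same x.  Relabelling the coins shows
  that the maximum is the same for every x with f fake coins.
\<close>

definition optimal_indiscreet ::
    "nat \<Rightarrow> nat \<Rightarrow> nat \<Rightarrow> (nat \<Rightarrow> int) \<Rightarrow> nat \<Rightarrow> strategy \<Rightarrow> bool" where
  "optimal_indiscreet t f d x m A \<longleftrightarrow>
    indiscreet t f d x m A \<and>
    (\<forall>m' A'. indiscreet t f d x m' A' \<longrightarrow>
      card (W t (syndrome t A' x m') (situations t f) m' A')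
        \<le> card (W t (syndrome t A x m) (situations t f) m A))"

end

theory Submission
  imports Defs "HOL-Library.Disjoint_Sets"
begin

text \<open>
  Write \<open>f = a F\<close>, let \<open>\<rho>\<close> and \<open>\<delta>\<close> be the remainders of \<open>t\<close> and \<open>d\<close> modulo \<open>a\<close>, and put
  \<open>k = \<lfloor>t/a\<rfloor> - \<lfloor>d/a\<rfloor>\<close>, so that \<open>\<lfloor>t/a\<rfloor> - \<lceil>d/a\<rceil> = k - 1\<close>.  In these terms the bound is
  \<open>C(k-1, F)^(\<delta>+1-\<rho>) C(k, F)^(a-(\<delta>+1-\<rho>))\<close>, and the first exponent may be negative.  It suffices
  to exhibit one indiscreet strategy that leaves at least that many situations open.

  All strategies used here consist of weighings known beforehand to balance.  A reserve \<open>R\<close> of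
  genuine coins is set aside, and the other coins are split into groups, each of weight 1 or 2, the
  weights adding up to \<open>a\<close>, so that a group of weight \<open>w\<close> contains \<open>w F\<close> fakes.  The weighings
  show that the coins of \<open>R\<close> are all alike, and that the groups, brought to sizes proportional to
  their weights by adding a coin \<open>q\<close> of \<open>R\<close>, hold fakes in proportion to their weights.  If \<open>q\<close> is
  genuine, the number of fakes is therefore divisible by \<open>a\<close>; if \<open>q\<close> is fake, the same computation
  applied to the complement shows that this number is congruent to \<open>t\<close> modulo \<open>a\<close>
  (\<open>grouping_number_of_fakes\<close>).  Hence \<open>f\<close> fakes force \<open>q\<close> to be genuine, which makes the strategy
  indiscreet, and \<open>d\<close> fakes are impossible as soon as either \<open>R\<close> has more than \<open>d\<close> coins or
  \<open>\<rho> \<noteq> \<delta>\<close> (\<open>grouping_strategy\<close>).  The number of open situations is at least the product of the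
  binomial coefficients that count the ways of placing the fakes inside the groups.

  If \<open>\<rho> \<le> \<delta> + 1\<close>, reserve \<open>d + 1\<close> coins: the others form \<open>\<delta>+1-\<rho>\<close> groups of size \<open>k - 1\<close> and
  \<open>a-(\<delta>+1-\<rho>)\<close> of size \<open>k\<close>, and the product is the bound itself.

  If \<open>\<rho> \<ge> \<delta> + 2\<close>, put \<open>j = \<rho> - \<delta> - 1\<close>.  The bound is then \<open>C(k, F)^a (k/(k-F))^j\<close>, and groups of
  sizes \<open>k\<close> and \<open>k + 1\<close> alone would fall short of it in general.  Now \<open>\<rho> \<noteq> \<delta>\<close>, so a reserve of \<open>d\<close>
  coins is enough, and merging two groups of size \<open>k + 1\<close> into one of weight 2 only leaves more
  situations open.  Each merged pair contributes \<open>C(2k+2, 2F) \<ge> (C(k, F) k/(k-F))^2\<close>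
  (\<open>choose_double_ge\<close>) and so pays for two of the factors \<open>k/(k-F)\<close>.
\<close>

section \<open>Balanced weighings\<close>

definition pans :: "nat \<Rightarrow> nat set \<Rightarrow> nat set \<Rightarrow> nat \<Rightarrow> int" where
  "pans t P Q = (\<lambda>i\<in>{1..t}. of_bool (i \<in> P) - of_bool (i \<in> Q))"

definition opposable :: "nat \<Rightarrow> nat set \<Rightarrow> nat set \<Rightarrow> bool" where
  "opposable t P Q \<longleftrightarrow>
    P \<subseteq> {1..t} \<and> Q \<subseteq> {1..t} \<and> P \<inter> Q = {} \<and> card P = card Q \<and> P \<noteq> {}"

lemma sum_mult_pans:
  assumes "P \<subseteq> {1..t}" "Q \<subseteq> {1..t}"
  shows "(\<Sum>i=1..t. z i * pans t P Q i) = sum z P - sum z Q"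
proof -
  have ind: "(\<Sum>i=1..t. z i * of_bool (i \<in> X)) = sum z X" if "X \<subseteq> {1..t}" for X
  proof -
    have "(\<Sum>i=1..t. z i * of_bool (i \<in> X)) = (\<Sum>i\<in>{1..t}. if i \<in> X then z i else 0)"
      by (intro sum.cong) auto
    also have "\<dots> = sum z ({1..t} \<inter> X)"
      by (rule sum.inter_restrict[symmetric]) simp
    finally show ?thesis using that by (simp add: Int_absorb1)
  qed
  have "(\<Sum>i=1..t. z i * pans t P Q i) =
      (\<Sum>i=1..t. z i * of_bool (i \<in> P) - z i * of_bool (i \<in> Q))"
    by (intro sum.cong) (auto simp: pans_def algebra_simps)
  then show ?thesis by (simp only: sum_subtractf ind assms)
qed

lemma pans_in_weighings:
  assumes "opposable t P Q"
  shows "pans t P Q \<in> weighings t"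
proof -
  have sub: "P \<subseteq> {1..t}" "Q \<subseteq> {1..t}" "P \<inter> Q = {}" "card P = card Q" "P \<noteq> {}"
    using assms by (auto simp: opposable_def)
  then obtain p where p: "p \<in> P" by blast
  have "pans t P Q \<in> {1..t} \<rightarrow>\<^sub>E {-1, 0, 1}"
    by (auto simp: pans_def)
  moreover have "\<exists>i\<in>{1..t}. pans t P Q i \<noteq> 0"
    using p sub by (intro bexI[of _ p]) (auto simp: pans_def)
  moreover have "(\<Sum>i=1..t. pans t P Q i) = 0"
    using sum_mult_pans[OF sub(1,2), of "\<lambda>_. 1"] sub(4) by simp
  ultimately show ?thesis by (simp add: weighings_def)
qed

lemma result_pans_eq_0_iff:
  assumes "opposable t P Q"
  shows "result t z (pans t P Q) = 0 \<longleftrightarrow> sum z P = sum z Q"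
  using assms sum_mult_pans[of P t Q z] by (auto simp: result_def opposable_def sgn_0_0)

lemma finite_situations: "finite (situations t n)"
  unfolding situations_def by (rule finite_subset[of _ "{1..t} \<rightarrow>\<^sub>E {0,1}"]) (auto intro!: finite_PiE)

lemma finite_weighings: "finite (weighings t)"
  unfolding weighings_def
  by (rule finite_subset[of _ "{1..t} \<rightarrow>\<^sub>E {-1,0,1}"]) (auto intro!: finite_PiE)

text \<open>
  Only weighings fixed in advance are needed, so the next weighing depends on the number of earlier
  results alone.  The syndrome then carries exactly the results of all weighings in \<open>H\<close>, which makes
  their order and number immaterial.
\<close>

lemma nonadaptive_strategy:
  assumes "finite H" "H \<subseteq> weighings t"
  obtains m A where "weighing_strategy t m A"
    "\<And>z z'. syndrome t A z m = syndrome t A z' m \<longleftrightarrow> (\<forall>h\<in>H. result t z h = result t z' h)"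
proof -
  obtain hs where hs: "set hs = H" using finite_list[OF assms(1)] by blast
  let ?A = "\<lambda>r. hs ! length r"
  have syn: "syndrome t ?A z n = map (result t z) (take n hs)" if "n \<le> length hs" for z n
    using that by (induction n) (auto simp: take_Suc_conv_app_nth)
  have "weighing_strategy t (length hs) ?A"
    using assms(2) hs by (auto simp: weighing_strategy_def)
  moreover have "syndrome t ?A z (length hs) = syndrome t ?A z' (length hs) \<longleftrightarrow>
      (\<forall>h\<in>H. result t z h = result t z' h)" for z z'
    by (simp add: syn hs)
  ultimately show thesis by (rule that)
qed

text \<open>
  The strategy performs every weighing that balances throughout the family \<open>V\<close>.  This spares
  listing weighings: \<open>V\<close> stays open by construction, and a particular weighing needs to be named only
  where a consequence of its balance is drawn.
\<close>

lemma strategy_for_family: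
  assumes "x \<in> V" "V \<subseteq> situations t f"
  obtains m A where "weighing_strategy t m A"
    "V \<subseteq> W t (syndrome t A x m) (situations t f) m A"
    "\<And>z Z P Q. \<lbrakk>z \<in> W t (syndrome t A x m) Z m A; opposable t P Q;
        \<And>v. v \<in> V \<Longrightarrow> sum v P = sum v Q\<rbrakk> \<Longrightarrow> sum z P = sum z Q"
proof -
  let ?H = "{h \<in> weighings t. \<forall>v\<in>V. result t v h = 0}"
  have "finite ?H" "?H \<subseteq> weighings t" using finite_weighings[of t] by auto
  then obtain m A where A: "weighing_strategy t m A"
    "\<And>z z'. syndrome t A z m = syndrome t A z' m \<longleftrightarrow> (\<forall>h\<in>?H. result t z h = result t z' h)"
    by (rule nonadaptive_strategy) blast
  show thesis
  proof (rule that[OF A(1)])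
    show "V \<subseteq> W t (syndrome t A x m) (situations t f) m A"
      using assms by (auto simp: W_def A(2))
  next
    fix z Z P Q
    assume z: "z \<in> W t (syndrome t A x m) Z m A" and op: "opposable t P Q"
      and bal: "\<And>v. v \<in> V \<Longrightarrow> sum v P = sum v Q"
    have "pans t P Q \<in> ?H"
      using pans_in_weighings[OF op] bal by (simp add: result_pans_eq_0_iff[OF op])
    then have "result t z (pans t P Q) = 0"
      using z A(2)[of z x] assms(1) by (auto simp: W_def)
    then show "sum z P = sum z Q" by (simp add: result_pans_eq_0_iff[OF op])
  qed
qed

section \<open>Groups of coins with prescribed numbers of fakes\<close>

lemma partition_with_cards:
  assumes "finite I" "finite X" "card X = (\<Sum>i\<in>I. n i)"
  shows "\<exists>P. disjoint_family_on P I \<and> (\<Union>i\<in>I. P i) = X \<and> (\<forall>i\<in>I. card (P i) = n i)"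
  using assms
proof (induction I arbitrary: X rule: finite_induct)
  case empty
  then show ?case by (auto simp: disjoint_family_on_def)
next
  case (insert j I)
  then have "n j \<le> card X" by simp
  then obtain Y where Y: "Y \<subseteq> X" "card Y = n j" "finite Y"
    by (rule obtain_subset_with_card_n)
  have "card (X - Y) = (\<Sum>i\<in>I. n i)"
    using insert Y by (simp add: card_Diff_subset)
  then obtain P where P: "disjoint_family_on P I" "(\<Union>i\<in>I. P i) = X - Y" "\<forall>i\<in>I. card (P i) = n i"
    using insert.IH[of "X - Y"] insert.prems by auto
  have "disjoint_family_on (P(j := Y)) (insert j I)"
  proof -
    have "P i \<inter> Y = {}" if "i \<in> I" for i using P(2) that by blast
    then show ?thesis
      using P(1) insert.hyps(2) by (simp add: disjoint_family_on_def Int_commute)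
  qed
  moreover have "(\<Union>i\<in>insert j I. (P(j := Y)) i) = X"
  proof -
    have "(\<Union>i\<in>insert j I. (P(j := Y)) i) = Y \<union> (\<Union>i\<in>I. P i)"
      using insert.hyps(2) by (auto split: if_splits)
    also have "\<dots> = X" unfolding P(2) using Y(1) by blast
    finally show ?thesis .
  qed
  moreover have "\<forall>i\<in>insert j I. card ((P(j := Y)) i) = n i"
    using P(3) Y(2) by simp
  ultimately show ?case by blast
qed

definition fakes :: "nat \<Rightarrow> (nat \<Rightarrow> int) \<Rightarrow> nat set" where
  "fakes t z = {i \<in> {1..t}. z i = 0}"

lemma finite_fakes [simp]: "finite (fakes t z)" by (simp add: fakes_def)

lemma situationsD:
  assumes "z \<in> situations t n"
  shows "card (fakes t z) = n" "\<And>i. i \<in> {1..t} \<Longrightarrow> z i = 0 \<or> z i = 1"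
  using assms by (auto simp: situations_def fakes_def PiE_iff)

lemma sum_situation:
  assumes z: "z \<in> situations t n" and X: "X \<subseteq> {1..t}"
  shows "sum z X = int (card X) - int (card (X \<inter> fakes t z))"
proof -
  have fin: "finite X" using X finite_subset by blast
  have "sum z X = (\<Sum>i\<in>X. 1 - of_bool (i \<in> fakes t z))"
  proof (rule sum.cong)
    fix i assume "i \<in> X"
    then show "z i = 1 - of_bool (i \<in> fakes t z)"
      using X situationsD(2)[OF z, of i] by (auto simp: fakes_def)
  qed simp
  also have "\<dots> = int (card X) - int (card (X \<inter> fakes t z))"
    using fin by (simp add: sum_subtractf Int_def)
  finally show ?thesis .
qed

text \<open>
  The family that stays open under the strategies below: the reserve \<open>R\<close> is genuine, and only the
  position of the fakes within each group is undetermined.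
\<close>

definition layout_situations ::
    "nat \<Rightarrow> nat \<Rightarrow> nat set \<Rightarrow> 'i set \<Rightarrow> ('i \<Rightarrow> nat set) \<Rightarrow> ('i \<Rightarrow> nat) \<Rightarrow> (nat \<Rightarrow> int) set" where
  "layout_situations t n R I S c =
    {z \<in> situations t n. R \<inter> fakes t z = {} \<and> (\<forall>i\<in>I. card (S i \<inter> fakes t z) = c i)}"

text \<open>
  A choice of \<open>c i\<close> fake coins inside every group \<open>S i\<close> determines a situation of the family, and
  the choice can be read off from that situation.
\<close>

lemma card_layout_situations:
  assumes I: "finite I" and dis: "disjoint_family_on S I"
    and un: "R \<union> (\<Union>i\<in>I. S i) = {1..t}" and RS: "R \<inter> (\<Union>i\<in>I. S i) = {}"
    and n: "n = (\<Sum>i\<in>I. c i)"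
  shows "(\<Prod>i\<in>I. card (S i) choose c i) \<le> card (layout_situations t n R I S c)"
proof -
  let ?B = "\<lambda>i. {B. B \<subseteq> S i \<and> card B = c i}"
  let ?z = "\<lambda>b. \<lambda>j\<in>{1..t}. of_bool (j \<notin> (\<Union>i\<in>I. b i)) :: int"
  have finS: "finite (S i)" if "i \<in> I" for i
    using un that by (metis Un_iff UN_I finite_atLeastAtMost finite_subset subsetI)
  have fz: "fakes t (?z b) = (\<Union>i\<in>I. b i)" if "b \<in> Pi\<^sub>E I ?B" for b
    using that un by (fastforce simp: fakes_def PiE_iff)
  have inter: "S i \<inter> fakes t (?z b) = b i" if b: "b \<in> Pi\<^sub>E I ?B" and i: "i \<in> I" for b i
  proof -
    have sub: "b j \<subseteq> S j" if "j \<in> I" for j using b that by (auto simp: PiE_iff)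
    have "S i \<inter> b j = {}" if "j \<in> I" "j \<noteq> i" for j
      using sub[OF that(1)] dis i that by (auto simp: disjoint_family_on_def)
    then show ?thesis unfolding fz[OF b] using sub i by blast
  qed
  have inj: "inj_on ?z (Pi\<^sub>E I ?B)"
  proof (rule inj_onI)
    fix b b' assume b: "b \<in> Pi\<^sub>E I ?B" and b': "b' \<in> Pi\<^sub>E I ?B" and eq: "?z b = ?z b'"
    show "b = b'"
    proof (rule PiE_ext[OF b b'])
      fix i assume "i \<in> I"
      then show "b i = b' i" using inter[OF b] inter[OF b'] eq by metis
    qed
  qed
  have img: "?z ` Pi\<^sub>E I ?B \<subseteq> layout_situations t n R I S c"
  proof
    fix z assume "z \<in> ?z ` Pi\<^sub>E I ?B"
    then obtain b where b: "b \<in> Pi\<^sub>E I ?B" and z: "z = ?z b" by blast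
    have sub: "b i \<subseteq> S i" and cb: "card (b i) = c i" if "i \<in> I" for i
      using b that by (auto simp: PiE_iff)
    have "card (fakes t z) = (\<Sum>i\<in>I. card (b i))"
      unfolding z fz[OF b] using I
    proof (rule card_UN_disjoint)
      show "\<forall>i\<in>I. finite (b i)" using sub finS finite_subset by blast
      show "\<forall>i\<in>I. \<forall>j\<in>I. i \<noteq> j \<longrightarrow> b i \<inter> b j = {}"
        using sub dis unfolding disjoint_family_on_def by blast
    qed
    also have "\<dots> = n" using cb n by simp
    finally have "z \<in> situations t n"
      by (auto simp: situations_def fakes_def z)
    moreover have "R \<inter> fakes t z = {}" unfolding z fz[OF b] using RS sub by blast
    moreover have "\<forall>i\<in>I. card (S i \<inter> fakes t z) = c i"
      using inter[OF b] cb by (simp add: z)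
    ultimately show "z \<in> layout_situations t n R I S c" by (simp add: layout_situations_def)
  qed
  have "(\<Prod>i\<in>I. card (S i) choose c i) = card (Pi\<^sub>E I ?B)"
    using I finS by (simp add: card_PiE n_subsets)
  also have "\<dots> \<le> card (layout_situations t n R I S c)"
    using inj img finite_situations by (intro card_inj_on_le) (auto simp: layout_situations_def)
  finally show ?thesis .
qed

text \<open>
  The true situation \<open>x\<close> is given, so the groups have to be fitted to it: the reserve is taken
  from the genuine coins of \<open>x\<close>, and its fakes and its remaining genuine coins are distributed
  separately.
\<close>

lemma layout_exists:
  assumes x: "x \<in> situations t n" and I: "finite I"
    and n: "n = (\<Sum>i\<in>I. c i)" and t: "t = r + (\<Sum>i\<in>I. g i)" and cg: "\<And>i. i \<in> I \<Longrightarrow> c i \<le> g i"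
  obtains R S where "disjoint_family_on S I" "R \<union> (\<Union>i\<in>I. S i) = {1..t}"
    "R \<inter> (\<Union>i\<in>I. S i) = {}" "card R = r" "\<And>i. i \<in> I \<Longrightarrow> card (S i) = g i"
    "x \<in> layout_situations t n R I S c"
proof -
  let ?G = "{1..t} - fakes t x"
  have fs: "fakes t x \<subseteq> {1..t}" by (auto simp: fakes_def)
  have sum: "(\<Sum>i\<in>I. g i - c i) + n = (\<Sum>i\<in>I. g i)"
    unfolding n using cg by (simp flip: sum.distrib)
  have cG: "card ?G = r + (\<Sum>i\<in>I. g i - c i)"
    using fs situationsD(1)[OF x] t sum by (simp add: card_Diff_subset)
  then obtain R where R: "R \<subseteq> ?G" "card R = r" "finite R"
    by (metis le_add1 obtain_subset_with_card_n)
  have "card (?G - R) = (\<Sum>i\<in>I. g i - c i)"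
    using cG R by (simp add: card_Diff_subset)
  then obtain P where P: "disjoint_family_on P I" "(\<Union>i\<in>I. P i) = ?G - R"
      "\<forall>i\<in>I. card (P i) = g i - c i"
    using partition_with_cards[OF I, of "?G - R" "\<lambda>i. g i - c i"] by auto
  obtain B where B: "disjoint_family_on B I" "(\<Union>i\<in>I. B i) = fakes t x" "\<forall>i\<in>I. card (B i) = c i"
    using partition_with_cards[OF I, of "fakes t x" c] situationsD(1)[OF x] n by auto
  let ?S = "\<lambda>i. P i \<union> B i"
  have PB: "P i \<subseteq> ?G - R" "B i \<subseteq> fakes t x" if "i \<in> I" for i
    using P(2) B(2) that by blast+
  show thesis
  proof (rule that)
    show "disjoint_family_on ?S I"
      using P(1) B(1) PB unfolding disjoint_family_on_def by blast
    have "(\<Union>i\<in>I. ?S i) = (?G - R) \<union> fakes t x"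
      using P(2) B(2) by blast
    then show "R \<union> (\<Union>i\<in>I. ?S i) = {1..t}" "R \<inter> (\<Union>i\<in>I. ?S i) = {}"
      using R(1) fs by auto
    show "card R = r" by fact
    show "card (?S i) = g i" if "i \<in> I" for i
    proof -
      have "finite (P i)" "finite (B i)" "P i \<inter> B i = {}"
        using PB[OF that] finite_subset[of "P i"] finite_subset[of "B i"] by auto
      then show ?thesis using P(3) B(3) cg that by (simp add: card_Un_disjoint)
    qed
    have "?S i \<inter> fakes t x = B i" if "i \<in> I" for i using PB[OF that] by blast
    then show "x \<in> layout_situations t n R I ?S c"
      using x R(1) B(3) by (auto simp: layout_situations_def)
  qed
qed

section \<open>The grouping strategy\<close>

text \<open>
  Here \<open>\<zeta>\<close> is the common value of the reserve coins.  The quantity \<open>g i * \<zeta> - sum z (S i)\<close> is the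
  number of fakes in group \<open>i\<close> if \<open>\<zeta> = 1\<close>, and minus the number of genuine coins there if
  \<open>\<zeta> = 0\<close>.  In this form it is unaffected by padding a group with reserve coins, and one linear
  identity covers both values of \<open>\<zeta>\<close>: modulo the total weight, the number of fakes is \<open>0\<close> or \<open>t\<close>.
\<close>

lemma grouping_number_of_fakes:
  fixes w g :: "'i \<Rightarrow> nat"
  assumes z: "z \<in> situations t n" and I: "finite I" and dis: "disjoint_family_on S I"
    and un: "R \<union> (\<Union>i\<in>I. S i) = {1..t}" and RS: "R \<inter> (\<Union>i\<in>I. S i) = {}"
    and cS: "\<And>i. i \<in> I \<Longrightarrow> card (S i) = g i"
    and R: "\<And>p. p \<in> R \<Longrightarrow> z p = \<zeta>"
    and G: "\<And>i. i \<in> I \<Longrightarrow> int (g i) * \<zeta> - sum z (S i) = int (w i) * v"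
  shows "int n = int t * (1 - \<zeta>) + int (\<Sum>i\<in>I. w i) * v"
proof -
  have "finite (R \<union> (\<Union>i\<in>I. S i))" unfolding un by simp
  then have fin: "finite R" "\<forall>i\<in>I. finite (S i)"
    using I by auto
  have D: "\<forall>i\<in>I. \<forall>j\<in>I. i \<noteq> j \<longrightarrow> S i \<inter> S j = {}"
    using dis by (auto simp: disjoint_family_on_def)
  have "sum z {1..t} = sum z R + sum z (\<Union>i\<in>I. S i)"
    using fin I RS by (subst un[symmetric], subst sum.union_disjoint) auto
  also have "sum z R = int (card R) * \<zeta>" using R by simp
  also have "sum z (\<Union>i\<in>I. S i) = (\<Sum>i\<in>I. sum z (S i))"
    using I fin(2) D by (rule sum.UNION_disjoint)
  also have "\<dots> = (\<Sum>i\<in>I. int (g i) * \<zeta> - int (w i) * v)"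
    using G by (intro sum.cong) (auto simp: algebra_simps)
  also have "\<dots> = int (\<Sum>i\<in>I. g i) * \<zeta> - int (\<Sum>i\<in>I. w i) * v"
    by (simp add: sum_subtractf sum_distrib_right)
  finally have s: "sum z {1..t} = int (card R + (\<Sum>i\<in>I. g i)) * \<zeta> - int (\<Sum>i\<in>I. w i) * v"
    by (simp add: algebra_simps)
  have "card {1..t} = card R + card (\<Union>i\<in>I. S i)"
    using fin I RS by (subst un[symmetric], subst card_Un_disjoint) auto
  also have "card (\<Union>i\<in>I. S i) = (\<Sum>i\<in>I. g i)"
    using I fin(2) D cS by (simp add: card_UN_disjoint)
  finally have "t = card R + (\<Sum>i\<in>I. g i)" by simp
  moreover have "sum z {1..t} = int t - int n"
  proof -
    have "{1..t} \<inter> fakes t z = fakes t z" by (auto simp: fakes_def)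
    then show ?thesis
      using sum_situation[OF z, of "{1..t}"] situationsD(1)[OF z] by simp
  qed
  ultimately show ?thesis using s by (simp add: algebra_simps)
qed

text \<open>
  One reserve coin \<open>q\<close> has to even out all comparisons with the base group \<open>b\<close> of size \<open>k\<close>.  This
  restricts the groups of weight 1 to the sizes \<open>k\<close> and \<open>k - 1\<close>.  A group of weight 2 and size \<open>2 k\<close>
  is weighed against \<open>b\<close>, a group of size \<open>k - 1\<close>, and \<open>q\<close>; hence one group of that smaller size must
  exist.  The two alternatives for \<open>r\<close> are the two ways to rule out \<open>d\<close> fakes with a fake reserve:
  the reserve alone is too large, or the residue modulo \<open>a\<close> is wrong.
\<close>

lemma grouping_strategy:
  fixes w g :: "'i \<Rightarrow> nat"
  assumes x: "x \<in> situations t f" and f: "f = a * F"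
    and ad: "\<not> a dvd d" and at: "\<not> a dvd t"
    and I: "finite I" and wsum: "(\<Sum>i\<in>I. w i) = a" and gsum: "t = r + (\<Sum>i\<in>I. g i)"
    and room: "\<And>i. i \<in> I \<Longrightarrow> w i * F \<le> g i"
    and base: "b \<in> I" "w b = 1" "g b = k" "k > 0"
    and groups: "\<And>i. i \<in> I \<Longrightarrow> w i = 1 \<and> (g i = k \<or> Suc (g i) = k) \<or>
        w i = 2 \<and> g i = 2 * k \<and> (\<exists>l\<in>I. w l = 1 \<and> Suc (g l) = k)"
    and r: "0 < r" "d < r \<or> t mod a \<noteq> d mod a"
  obtains m A where "indiscreet t f d x m A"
    "(\<Prod>i\<in>I. g i choose (w i * F)) \<le> card (W t (syndrome t A x m) (situations t f) m A)"
proof -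
  have fsum: "f = (\<Sum>i\<in>I. w i * F)" by (simp add: f flip: wsum sum_distrib_right)
  obtain R S where dis: "disjoint_family_on S I" and un: "R \<union> (\<Union>i\<in>I. S i) = {1..t}"
    and RS: "R \<inter> (\<Union>i\<in>I. S i) = {}" and cR: "card R = r"
    and cS: "\<And>i. i \<in> I \<Longrightarrow> card (S i) = g i"
    and xV: "x \<in> layout_situations t f R I S (\<lambda>i. w i * F)"
    by (rule layout_exists[OF x I fsum gsum room]) blast+
  let ?V = "layout_situations t f R I S (\<lambda>i. w i * F)"
  have "?V \<subseteq> situations t f" by (auto simp: layout_situations_def)
  from strategy_for_family[OF xV this] obtain m A where str: "weighing_strategy t m A"
    and VW: "?V \<subseteq> W t (syndrome t A x m) (situations t f) m A"
    and bal: "\<And>z Z P Q. \<lbrakk>z \<in> W t (syndrome t A x m) Z m A; opposable t P Q;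
        \<And>v. v \<in> ?V \<Longrightarrow> sum v P = sum v Q\<rbrakk> \<Longrightarrow> sum z P = sum z Q"
    by blast
  obtain q where q: "q \<in> R" using cR r(1) by fastforce
  have Ssub: "S i \<subseteq> {1..t}" if "i \<in> I" for i using un that by blast
  have finS: "finite (S i)" if "i \<in> I" for i using Ssub[OF that] finite_subset by blast
  have Rsub: "R \<subseteq> {1..t}" using un by blast
  have qS: "q \<notin> S i" if "i \<in> I" for i using RS q that by blast
  have SS: "S i \<inter> S l = {}" if "i \<in> I" "l \<in> I" "i \<noteq> l" for i l
    using dis that by (auto simp: disjoint_family_on_def)
  have VS: "sum v (S i) = int (g i) - int (w i * F)" if "v \<in> ?V" "i \<in> I" for v i
    using that sum_situation[of v t f "S i"] Ssub cS by (simp add: layout_situations_def)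
  have VR: "v p = 1" if "v \<in> ?V" "p \<in> R" for v p
  proof -
    have "p \<in> {1..t}" "p \<notin> fakes t v" "v \<in> situations t f"
      using that Rsub by (auto simp: layout_situations_def)
    then show ?thesis using situationsD(2)[of v t f p] by (auto simp: fakes_def)
  qed
  have Sb: "S b \<noteq> {}" using cS[OF base(1)] base by auto

  \<comment> \<open>Needed twice: for \<open>n = d\<close> it leads to a contradiction, for \<open>n = f\<close> it makes \<open>q\<close> genuine.\<close>
  have number: "int n = int t * (1 - z q) + int a * (int k * z q - sum z (S b)) \<and>
      (\<forall>p\<in>R. z p = z q)"
    if zW: "z \<in> W t (syndrome t A x m) (situations t n) m A" for z n
  proof -
    have z: "z \<in> situations t n" using zW by (simp add: W_def)
    have R: "z p = z q" if "p \<in> R" for p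
    proof (cases "p = q")
      case False
      have "opposable t {p} {q}" using False that q Rsub by (auto simp: opposable_def)
      moreover have "sum v {p} = sum v {q}" if "v \<in> ?V" for v
        using VR[OF that \<open>p \<in> R\<close>] VR[OF that q] by simp
      ultimately have "sum z {p} = sum z {q}" by (rule bal[OF zW])
      then show ?thesis by simp
    qed simp
    have single: "int (g i) * z q - sum z (S i) = int k * z q - sum z (S b)"
      if i: "i \<in> I" "w i = 1" "g i = k \<or> Suc (g i) = k" for i
    proof (cases "i = b")
      case True then show ?thesis using base by simp
    next
      case ne: False
      from i(3) show ?thesis
      proof
        assume gi: "g i = k"
        have "opposable t (S b) (S i)"
          using ne base gi Sb SS[OF base(1) i(1)] cS[OF i(1)] cS[OF base(1)]
            Ssub[OF i(1)] Ssub[OF base(1)]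
          by (simp add: opposable_def)
        moreover have "sum v (S b) = sum v (S i)" if "v \<in> ?V" for v
          using VS[OF that base(1)] VS[OF that i(1)] base i gi by simp
        ultimately have "sum z (S b) = sum z (S i)" by (rule bal[OF zW])
        then show ?thesis using gi by simp
      next
        assume gi: "Suc (g i) = k"
        have sumq: "sum y (insert q (S i)) = y q + sum y (S i)" for y :: "nat \<Rightarrow> int"
          using qS[OF i(1)] finS[OF i(1)] by simp
        have "opposable t (S b) (insert q (S i))"
          using ne base gi Sb SS[OF base(1) i(1)] cS[OF i(1)] cS[OF base(1)]
            Ssub[OF i(1)] Ssub[OF base(1)] q Rsub qS[OF i(1)] qS[OF base(1)] finS[OF i(1)]
          by (auto simp: opposable_def)
        moreover have "sum v (S b) = sum v (insert q (S i))" if "v \<in> ?V" for v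
          unfolding sumq
          using VS[OF that base(1)] VS[OF that i(1)] VR[OF that q] base i gi by auto
        ultimately have "sum z (S b) = sum z (insert q (S i))" by (rule bal[OF zW])
        then have "sum z (S b) = z q + sum z (S i)" by (simp only: sumq)
        moreover have "int k = int (g i) + 1" using gi by simp
        ultimately show ?thesis by (simp add: algebra_simps)
      qed
    qed
    have "int (g i) * z q - sum z (S i) = int (w i) * (int k * z q - sum z (S b))"
      if i: "i \<in> I" for i
      using groups[OF i]
    proof (elim disjE conjE bexE)
      fix l assume wi: "w i = 2" and gi: "g i = 2 * k" and l: "l \<in> I" "w l = 1" "Suc (g l) = k"
      have ne: "b \<noteq> l" "b \<noteq> i" "l \<noteq> i" using base l wi by auto
      let ?P = "insert q (S b \<union> S l)"
      have sumP: "sum y ?P = y q + (sum y (S b) + sum y (S l))" for y :: "nat \<Rightarrow> int"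
        using qS[OF base(1)] qS[OF l(1)] finS[OF base(1)] finS[OF l(1)]
          SS[OF base(1) l(1) ne(1)]
        by (simp add: sum.union_disjoint)
      have "card ?P = 2 * k"
        using qS[OF base(1)] qS[OF l(1)] finS[OF base(1)] finS[OF l(1)]
          SS[OF base(1) l(1) ne(1)] cS[OF base(1)] cS[OF l(1)] base(3) l(3)
        by (simp add: card_Un_disjoint)
      moreover have "?P \<inter> S i = {}"
        using SS[OF base(1) i ne(2)] SS[OF l(1) i ne(3)] qS[OF i] by auto
      moreover have "?P \<subseteq> {1..t}" using Ssub[OF base(1)] Ssub[OF l(1)] q Rsub by auto
      ultimately have "opposable t ?P (S i)"
        using Ssub[OF i] cS[OF i] gi by (simp add: opposable_def)
      moreover have "sum v ?P = sum v (S i)" if "v \<in> ?V" for v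
        using VS[OF that base(1)] VS[OF that l(1)] VS[OF that i] VR[OF that q] base l wi gi
        by (auto simp: sumP)
      ultimately have "sum z ?P = sum z (S i)" by (rule bal[OF zW])
      moreover have "int (g l) * z q - sum z (S l) = int k * z q - sum z (S b)"
        using single[of l] l by blast
      moreover have "int (g l) = int k - 1" using l(3) by simp
      ultimately show ?thesis unfolding sumP wi gi by (simp add: algebra_simps)
    qed (use single[OF i] in auto)
    from grouping_number_of_fakes[OF z I dis un RS cS R this]
    show ?thesis using R by (simp add: wsum)
  qed

  have z01: "z q = 0 \<or> z q = 1" if "z \<in> W t (syndrome t A x m) (situations t n) m A" for z n
    using that situationsD(2)[of z t n q] q Rsub by (auto simp: W_def)
  have no_d: "W t (syndrome t A x m) (situations t d) m A = {}"
  proof (rule ccontr)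
    assume "\<not> ?thesis"
    then obtain z where zW: "z \<in> W t (syndrome t A x m) (situations t d) m A" by blast
    note num = number[OF zW]
    from z01[OF zW] show False
    proof
      assume "z q = 1"
      then have "int a dvd int d" using num by simp
      then show False using ad by simp
    next
      assume zq: "z q = 0"
      then have "R \<subseteq> fakes t z" using num Rsub by (auto simp: fakes_def)
      then have "r \<le> d"
        using card_mono[of "fakes t z" R] cR situationsD(1)[of z t d] zW by (simp add: W_def)
      moreover have "int d mod int a = int t mod int a"
        using num zq by (metis diff_zero mod_mult_self2 mult.right_neutral)
      then have "d mod a = t mod a" by (simp flip: zmod_int)
      ultimately show False using r(2) by simp
    qed
  qed
  have genuine: "z q = 1" if "z \<in> W t (syndrome t A x m) (situations t f) m A" for z
  proof (rule ccontr)
    assume "z q \<noteq> 1"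
    then have "int f = int t - int a * sum z (S b)" using number[OF that] z01[OF that] by auto
    then have "int t = int a * (int F + sum z (S b))" by (simp add: f algebra_simps)
    then have "int a dvd int t" by simp
    then show False using at by simp
  qed
  have finW: "finite (W t (syndrome t A x m) (situations t f) m A)"
    using finite_situations by (simp add: W_def)
  have "card (W t (syndrome t A x m) (situations t f) m A) > 0"
    using finW xV VW card_gt_0_iff by blast
  then have "successful t f d x m A" using str no_d by (simp add: successful_def)
  moreover have "(\<lambda>z. z q) ` W t (syndrome t A x m) (situations t f) m A \<noteq> {0, 1}"
  proof
    assume "(\<lambda>z. z q) ` W t (syndrome t A x m) (situations t f) m A = {0, 1}"
    then have "0 \<in> (\<lambda>z. z q) ` W t (syndrome t A x m) (situations t f) m A" by simp
    then show False using genuine by force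
  qed
  then have "\<not> discreet t f d x m A" using q Rsub by (auto simp: discreet_def)
  ultimately have "indiscreet t f d x m A" by (simp add: indiscreet_def)
  moreover have "(\<Prod>i\<in>I. g i choose (w i * F)) \<le> card ?V"
    using card_layout_situations[OF I dis un RS fsum] cS by simp
  then have "(\<Prod>i\<in>I. g i choose (w i * F)) \<le> card (W t (syndrome t A x m) (situations t f) m A)"
    using card_mono[OF finW VW] by linarith
  ultimately show thesis by (rule that)
qed

section \<open>Binomial estimates\<close>

lemma Suc_choose_ratio:
  assumes "F \<le> n"
  shows "real (Suc n choose F) = real (n choose F) * (real n + 1) / (real n + 1 - real F)"
proof -
  have "Suc n * (n choose F) = (Suc n choose F) * (Suc n - F)"
    using binomial_absorb_comp[of "Suc n" F] by (simp add: mult.commute)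
  then have "real (Suc n) * real (n choose F) = real (Suc n choose F) * real (Suc n - F)"
    by (metis of_nat_mult)
  then show ?thesis using assms by (simp add: field_simps of_nat_diff)
qed

lemma choose_Suc_ratio:
  assumes "F \<le> n"
  shows "real (n choose Suc F) = real (n choose F) * (real n - real F) / (real F + 1)"
proof -
  have "Suc F * (n choose Suc F) = (n - F) * (n choose F)"
    by (simp only: binomial_absorb_comp binomial_absorption)
  then have "real (Suc F) * real (n choose Suc F) = real (n - F) * real (n choose F)"
    by (metis of_nat_mult)
  then show ?thesis using assms by (simp add: field_simps of_nat_diff)
qed

lemma choose_neighbours:
  assumes "0 < F" "F < n"
  shows "real (n choose (F - 1)) * real (n choose Suc F) =
    (real (n choose F))\<^sup>2 *
      (real F * (real n - real F) / ((real F + 1) * (real n - real F + 1)))"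
proof -
  have "real (n choose F) = real (n choose (F - 1)) * (real n - real F + 1) / real F"
    using choose_Suc_ratio[of "F - 1" n] assms by (simp add: of_nat_diff)
  then have "real (n choose (F - 1)) = real (n choose F) * real F / (real n - real F + 1)"
    using assms by (simp add: field_simps)
  then show ?thesis
    using choose_Suc_ratio[of F n] assms by (simp add: power2_eq_square mult_ac)
qed

text \<open>
  Of all ways to share \<open>2 F\<close> fakes between two groups of size \<open>n\<close>, keep the even split and the two
  splits next to it.  The even split alone would give just the square, which is too small for
  \<open>choose_double_ge\<close>.
\<close>

lemma choose_double_ge_neighbours:
  assumes "0 < F"
  shows "(n choose F)\<^sup>2 + 2 * ((n choose (F - 1)) * (n choose Suc F)) \<le> (2 * n choose (2 * F))"
proof -
  let ?f = "\<lambda>k. (n choose k) * (n choose (2 * F - k))"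
  obtain G where G: "F = Suc G" using assms by (cases F) auto
  have eq: "2 * Suc G - G = Suc (Suc G)" "2 * Suc G - Suc (Suc G) = G" "2 * Suc G - Suc G = Suc G"
    by auto
  have "(n choose F)\<^sup>2 + 2 * ((n choose (F - 1)) * (n choose Suc F)) = sum ?f {F - 1, F, Suc F}"
    unfolding G diff_Suc_1 power2_eq_square by (simp add: eq del: mult_Suc_right)
  also have "\<dots> \<le> sum ?f {..2 * F}"
    using assms by (intro sum_mono2) auto
  also have "\<dots> = (2 * n choose (2 * F))"
    by (simp only: vandermonde mult_2)
  finally show ?thesis .
qed

text \<open>
  The inequality behind \<open>choose_double_ge\<close>, with \<open>\<phi> = F\<close> and \<open>u = k - F\<close>.  The quotient of
  \<open>(\<phi> + u) / u\<close> by \<open>(\<phi> + u + 1) / (u + 1)\<close> is \<open>1 + y\<close> with \<open>y\<close> small, and the gain from the two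
  neighbouring splits, which is at least \<open>3/2 \<cdot> \<phi> / (\<phi> + 1)\<close>, exceeds \<open>2 y + y^2\<close>.
\<close>

lemma double_ratio_estimate:
  fixes \<phi> u :: real
  assumes "\<phi> > 0" "u \<ge> 2"
  shows "((\<phi> + u) / u)\<^sup>2 \<le>
    ((\<phi> + u + 1) / (u + 1))\<^sup>2 * (1 + 2 * (\<phi> * (u + 1) / ((\<phi> + 1) * (u + 2))))"
proof -
  define y where "y = \<phi> / (u * (\<phi> + u + 1))"
  have "2 * (\<phi> + 1) \<le> u * (\<phi> + u + 1)"
    using assms by (intro mult_mono) auto
  then have y1: "y \<le> \<phi> / (2 * (\<phi> + 1))"
    unfolding y_def using assms by (intro divide_left_mono) auto
  have "\<phi> / (2 * (\<phi> + 1)) \<le> 1 / 2" using assms by (simp add: field_simps)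
  then have y2: "y \<le> 1 / 2" using y1 by linarith
  have y0: "0 \<le> y" using assms by (simp add: y_def)
  have "(1 + y)\<^sup>2 = 1 + 2 * y + y * y" by (simp add: power2_eq_square algebra_simps)
  also have "\<dots> \<le> 1 + 5 / 2 * y" using mult_right_mono[OF y2 y0] by simp
  also have "\<dots> \<le> 1 + 5 / 2 * (\<phi> / (2 * (\<phi> + 1)))"
    using y1 by (intro add_left_mono mult_left_mono) auto
  also have "\<dots> \<le> 1 + 2 * (\<phi> / (\<phi> + 1) * (3 / 4))"
    using assms by (simp add: field_simps)
  also have "\<dots> \<le> 1 + 2 * (\<phi> / (\<phi> + 1) * ((u + 1) / (u + 2)))"
    using assms by (intro add_left_mono mult_left_mono) (auto simp: field_simps)
  also have "\<dots> = 1 + 2 * (\<phi> * (u + 1) / ((\<phi> + 1) * (u + 2)))"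
    by simp
  finally have main: "(1 + y)\<^sup>2 \<le> 1 + 2 * (\<phi> * (u + 1) / ((\<phi> + 1) * (u + 2)))" .
  have "(\<phi> + u) / u = (\<phi> + u + 1) / (u + 1) * (1 + y)"
    using assms by (simp add: y_def add_pos_pos divide_simps) (simp add: algebra_simps)
  then have "((\<phi> + u) / u)\<^sup>2 = ((\<phi> + u + 1) / (u + 1))\<^sup>2 * (1 + y)\<^sup>2"
    by (simp only: power_mult_distrib)
  also have "\<dots> \<le> ((\<phi> + u + 1) / (u + 1))\<^sup>2 * (1 + 2 * (\<phi> * (u + 1) / ((\<phi> + 1) * (u + 2))))"
    using main by (intro mult_left_mono) auto
  finally show ?thesis .
qed

text \<open>
  What one merged pair of groups of size \<open>k + 1\<close> contributes when the bound asks for two groups of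
  size \<open>k\<close> and two factors \<open>k / (k - F)\<close>.
\<close>

lemma choose_double_ge:
  assumes "F + 2 \<le> k"
  shows "(real (k choose F) * (real k / (real k - real F)))\<^sup>2 \<le> real (2 * Suc k choose (2 * F))"
proof (cases "F = 0")
  case True
  then show ?thesis using assms by simp
next
  case False
  define u where "u = real k - real F"
  have u: "u \<ge> 2" "real k = real F + u" using assms by (auto simp: u_def)
  let ?c = "real (k choose F)" and ?C = "real (Suc k choose F)"
  let ?r = "real F * (u + 1) / ((real F + 1) * (u + 2))"
  have C: "?C = ?c * ((real F + u + 1) / (u + 1))"
    using Suc_choose_ratio[of F k] assms u(2) by (simp add: add_ac)
  have "real (Suc k) - real F = u + 1" "real (Suc k) - real F + 1 = u + 2" using u by auto
  then have nb: "real (Suc k choose (F - 1)) * real (Suc k choose Suc F) = ?C\<^sup>2 * ?r"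
    using choose_neighbours[of F "Suc k"] False assms by (simp only:)
  have "(?c * (real k / (real k - real F)))\<^sup>2 = ?c\<^sup>2 * ((real F + u) / u)\<^sup>2"
    by (simp add: u(2) power_mult_distrib power_divide)
  also have "\<dots> \<le> ?c\<^sup>2 * (((real F + u + 1) / (u + 1))\<^sup>2 * (1 + 2 * ?r))"
    using double_ratio_estimate[of "real F" u] False u by (intro mult_left_mono) auto
  also have "\<dots> = ?C\<^sup>2 + 2 * (?C\<^sup>2 * ?r)"
    unfolding C power_mult_distrib by (simp add: algebra_simps)
  also have "\<dots> = real ((Suc k choose F)\<^sup>2 + 2 * ((Suc k choose (F - 1)) * (Suc k choose Suc F)))"
    unfolding nb[symmetric] by simp
  also have "\<dots> \<le> real (2 * Suc k choose (2 * F))"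
    using choose_double_ge_neighbours[of F "Suc k"] False of_nat_mono by blast
  finally show ?thesis .
qed

text \<open>
  For a single factor \<open>k / (k - F)\<close>, enlarging two groups from \<open>k\<close> to \<open>k + 1\<close> suffices without merging
  them; this settles odd \<open>j\<close>.
\<close>

lemma choose_Suc_square_ge:
  assumes "F < k"
  shows "(real (k choose F))\<^sup>2 * (real k / (real k - real F)) \<le> (real (Suc k choose F))\<^sup>2"
proof -
  define u \<phi> where "u = real k - real F" and "\<phi> = real F"
  have u: "u \<ge> 1" "\<phi> \<ge> 0" "real k = \<phi> + u" using assms by (auto simp: u_def \<phi>_def)
  have "(\<phi> + u) * (u + 1)\<^sup>2 \<le> u * (\<phi> + u + 1)\<^sup>2"
  proof -
    have "u * (\<phi> + u + 1)\<^sup>2 - (\<phi> + u) * (u + 1)\<^sup>2 = \<phi> * (u * u - 1) + u * \<phi>\<^sup>2"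
      by (simp add: power2_eq_square algebra_simps)
    moreover have "u * u \<ge> 1 * 1" using u by (intro mult_mono) auto
    ultimately show ?thesis using u by (smt (verit) mult_nonneg_nonneg zero_le_power2)
  qed
  then have "(\<phi> + u) / u \<le> ((\<phi> + u + 1) / (u + 1))\<^sup>2"
    using u by (simp add: power_divide field_simps)
  then have "(real (k choose F))\<^sup>2 * ((\<phi> + u) / u) \<le>
      (real (k choose F))\<^sup>2 * ((\<phi> + u + 1) / (u + 1))\<^sup>2"
    by (intro mult_left_mono) auto
  also have "\<dots> = (real (k choose F) * (\<phi> + u + 1) / (u + 1))\<^sup>2"
    by (simp add: power_mult_distrib power_divide)
  also have "\<dots> = (real (Suc k choose F))\<^sup>2"
    using Suc_choose_ratio[of F k] assms by (simp add: u_def \<phi>_def add_ac)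
  finally show ?thesis by (simp add: u_def \<phi>_def)
qed

section \<open>The two choices of groups\<close>

text \<open>
  The groups for \<open>\<rho> \<le> \<delta> + 1\<close>.  With \<open>d + 1\<close> reserve coins, a fake reserve already contains more than
  \<open>d\<close> fakes.
\<close>

lemma single_groups_strategy:
  assumes x: "x \<in> situations t f" and f: "f = a * F"
    and ad: "\<not> a dvd d" and at: "\<not> a dvd t"
    and t: "t = Suc d + (e * (k - 1) + e' * k)" and a: "e + e' = a" and e': "0 < e'" and F: "F < k"
  obtains m A where "indiscreet t f d x m A"
    "(k - 1 choose F) ^ e * (k choose F) ^ e' \<le>
      card (W t (syndrome t A x m) (situations t f) m A)"
proof -
  let ?I = "{..<e} <+> {..<e'}"
  let ?w = "\<lambda>i :: nat + nat. 1 :: nat" and ?g = "case_sum (\<lambda>_. k - 1) (\<lambda>_. k)"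
  have wsum: "sum ?w ?I = a" using a by (simp add: sum.Plus card_Plus)
  have gsum: "t = Suc d + sum ?g ?I" using t by (simp add: sum.Plus)
  have room: "?w i * F \<le> ?g i" if "i \<in> ?I" for i using that F by auto
  have base: "Inr 0 \<in> ?I" "?w (Inr 0) = 1" "?g (Inr 0) = k" "k > 0" using e' F by auto
  have "?w i = 1 \<and> (?g i = k \<or> Suc (?g i) = k) \<or>
        ?w i = 2 \<and> ?g i = 2 * k \<and> (\<exists>l\<in>?I. ?w l = 1 \<and> Suc (?g l) = k)" if "i \<in> ?I" for i
    using that F by auto
  from grouping_strategy[OF x f ad at _ wsum gsum room base this]
  obtain m A where "indiscreet t f d x m A"
    and le: "(\<Prod>i\<in>?I. ?g i choose (?w i * F)) \<le> card (W t (syndrome t A x m) (situations t f) m A)"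
    by auto
  moreover have "(\<Prod>i\<in>?I. ?g i choose (?w i * F)) = (k - 1 choose F) ^ e * (k choose F) ^ e'"
    by (simp add: prod.Plus)
  ultimately show thesis using that by metis
qed

text \<open>
  The groups for \<open>\<rho> \<ge> \<delta> + 2\<close>: \<open>e\<close> of size \<open>k + 1\<close> and \<open>e'\<close> of size \<open>k\<close>, both of weight 1, and \<open>p\<close>
  merged ones.  The base group has size \<open>k + 1\<close> here, and at least one group of each of the two
  smaller sizes is kept to calibrate the merged ones.
\<close>

lemma double_groups_strategy:
  assumes x: "x \<in> situations t f" and f: "f = a * F"
    and ad: "\<not> a dvd d" and at: "\<not> a dvd t" and td: "t mod a \<noteq> d mod a"
    and t: "t = d + (e * Suc k + e' * k + p * (2 * Suc k))" and a: "e + e' + 2 * p = a"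
    and e: "0 < e" "0 < e'" and F: "F \<le> k"
  obtains m A where "indiscreet t f d x m A"
    "(Suc k choose F) ^ e * (k choose F) ^ e' * (2 * Suc k choose (2 * F)) ^ p \<le>
      card (W t (syndrome t A x m) (situations t f) m A)"
proof -
  let ?I = "({..<e} <+> {..<e'}) <+> {..<p}"
  let ?w = "case_sum (\<lambda>_. 1) (\<lambda>_. 2) :: (nat + nat) + nat \<Rightarrow> nat"
  let ?g = "case_sum (case_sum (\<lambda>_. Suc k) (\<lambda>_. k)) (\<lambda>_. 2 * Suc k)"
  have wsum: "sum ?w ?I = a" using a by (simp add: sum.Plus card_Plus)
  have gsum: "t = d + sum ?g ?I" using t by (simp add: sum.Plus)
  have room: "?w i * F \<le> ?g i" if "i \<in> ?I" for i using that F by auto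
  have base: "Inl (Inl 0) \<in> ?I" "?w (Inl (Inl 0)) = 1" "?g (Inl (Inl 0)) = Suc k" "Suc k > 0"
    using e by auto
  have groups: "?w i = 1 \<and> (?g i = Suc k \<or> Suc (?g i) = Suc k) \<or>
        ?w i = 2 \<and> ?g i = 2 * Suc k \<and> (\<exists>l\<in>?I. ?w l = 1 \<and> Suc (?g l) = Suc k)" if "i \<in> ?I" for i
  proof -
    have "\<exists>l\<in>?I. ?w l = 1 \<and> Suc (?g l) = Suc k"
      using e(2) by (intro bexI[of _ "Inl (Inr 0)"]) auto
    then show ?thesis using that by auto
  qed
  have "0 < d" using ad by (cases d) auto
  from grouping_strategy[OF x f ad at _ wsum gsum room base groups this] td
  obtain m A where "indiscreet t f d x m A"
    and le: "(\<Prod>i\<in>?I. ?g i choose (?w i * F)) \<le> card (W t (syndrome t A x m) (situations t f) m A)"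
    by auto
  moreover have "(\<Prod>i\<in>?I. ?g i choose (?w i * F)) =
      (Suc k choose F) ^ e * (k choose F) ^ e' * (2 * Suc k choose (2 * F)) ^ p"
    by (simp add: prod.Plus del: binomial_Suc_Suc)
  ultimately show thesis using that by metis
qed

text \<open>
  The factors \<open>k / (k - F)\<close> are charged in pairs to the \<open>p\<close> merged groups.  If \<open>\<epsilon> = 1\<close>, one factor
  is left over and is charged to the two groups of size \<open>k + 1\<close>.
\<close>

lemma double_groups_count_ge:
  assumes F: "F + 2 \<le> k" and \<epsilon>: "\<epsilon> \<le> 1"
  shows "real (k choose F) ^ (Suc \<epsilon> + e' + 2 * p) * (real k / (real k - real F)) ^ (2 * p + \<epsilon>)
    \<le> real ((Suc k choose F) ^ Suc \<epsilon> * (k choose F) ^ e' * (2 * Suc k choose (2 * F)) ^ p)"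
proof -
  let ?c = "real (k choose F)" and ?q = "real k / (real k - real F)"
  have q: "?q \<ge> 0" using F by simp
  have "k choose F \<le> Suc k choose F" by (cases F) auto
  then have "?c ^ Suc \<epsilon> * ?q ^ \<epsilon> \<le> real (Suc k choose F) ^ Suc \<epsilon>"
    using \<epsilon> choose_Suc_square_ge[of F k] F
    by (cases "\<epsilon> = 0") (auto simp: power2_eq_square le_Suc_eq simp del: binomial_Suc_Suc)
  moreover have "((?c * ?q)\<^sup>2) ^ p \<le> real (2 * Suc k choose (2 * F)) ^ p"
    using choose_double_ge[OF F] by (intro power_mono) auto
  ultimately have "(?c ^ Suc \<epsilon> * ?q ^ \<epsilon>) * ?c ^ e' * ((?c * ?q)\<^sup>2) ^ p \<le>
      real (Suc k choose F) ^ Suc \<epsilon> * ?c ^ e' * real (2 * Suc k choose (2 * F)) ^ p"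
    using q by (intro mult_mono mult_nonneg_nonneg) auto
  moreover have "?c ^ (Suc \<epsilon> + e' + 2 * p) * ?q ^ (2 * p + \<epsilon>) =
      (?c ^ Suc \<epsilon> * ?q ^ \<epsilon>) * ?c ^ e' * ((?c * ?q)\<^sup>2) ^ p"
    unfolding power_add power_mult power_mult_distrib by (simp only: mult_ac)
  ultimately show ?thesis by (simp only: of_nat_mult of_nat_power)
qed

theorem theorem3:
  fixes t f d a m :: nat and x :: "nat \<Rightarrow> int" and A :: strategy
  assumes "f \<le> t" and "d \<le> t" and "f \<noteq> d"
    and "a > 1" and "a dvd f" and "\<not> a dvd d" and "\<not> a dvd t" and "t > 2 * a"
    and "real_of_int (\<lfloor>real t / real a\<rfloor> - \<lceil>real d / real a\<rceil>) > real f / real a"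
    and "x \<in> situations t f"
    and "optimal_indiscreet t f d x m A"
  shows
    "real (nat (\<lfloor>real t / real a\<rfloor> - \<lceil>real d / real a\<rceil>) choose (f div a))
        powi (int a * \<lfloor>real t / real a\<rfloor> - int a * \<lfloor>real d / real a\<rfloor> + int d + 1 - int t) *
     real (nat (\<lfloor>real t / real a\<rfloor> - \<lfloor>real d / real a\<rfloor>) choose (f div a))
        powi (int a - int a * \<lfloor>real t / real a\<rfloor> + int a * \<lfloor>real d / real a\<rfloor> - int d - 1 + int t)
     \<le> real (card (W t (syndrome t A x m) (situations t f) m A))"
proof -
  let ?card = "\<lambda>m A. card (W t (syndrome t A x m) (situations t f) m A)"
  note a1 = \<open>a > 1\<close> and ad = \<open>\<not> a dvd d\<close> and at = \<open>\<not> a dvd t\<close> and x = \<open>x \<in> situations t f\<close>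
  have best: "?card m' A' \<le> ?card m A" if "indiscreet t f d x m' A'" for m' A'
    using assms(11) that by (simp add: optimal_indiscreet_def)
  define F \<rho> \<delta> where "F = f div a" and "\<rho> = t mod a" and "\<delta> = d mod a"
  have f: "f = a * F" using \<open>a dvd f\<close> by (simp add: F_def)
  have \<delta>: "0 < \<delta>" "\<delta> < a" and \<rho>: "\<rho> < a"
    using ad a1 by (auto simp: \<delta>_def \<rho>_def dvd_eq_mod_eq_0)
  have flt: "\<lfloor>real t / real a\<rfloor> = int (t div a)" and fld: "\<lfloor>real d / real a\<rfloor> = int (d div a)"
    by (simp_all add: floor_divide_of_nat_eq)
  have d: "d = a * (d div a) + \<delta>" and t: "t = a * (t div a) + \<rho>" by (simp_all add: \<delta>_def \<rho>_def)
  have cld: "\<lceil>real d / real a\<rceil> = int (d div a) + 1"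
  proof (rule ceiling_unique)
    have "real d = real a * real (d div a) + real \<delta>" by (subst d) simp
    then have "real d / real a = real (d div a) + real \<delta> / real a" using a1 by (simp add: field_simps)
    moreover have "0 < real \<delta> / real a" "real \<delta> / real a \<le> 1" using \<delta> a1 by auto
    ultimately show "real_of_int (int (d div a) + 1) - 1 < real d / real a"
      "real d / real a \<le> real_of_int (int (d div a) + 1)" by auto
  qed
  have "real f / real a = real F" using f a1 by simp
  then have "real_of_int (int (t div a) - (int (d div a) + 1)) > real_of_int (int F)"
    using assms(9) by (simp add: flt cld)
  then have gap: "int (t div a) - int (d div a) > int F + 1" by linarith
  define k where "k = t div a - d div a"
  have k: "F + 2 \<le> k" "t div a = d div a + k" using gap by (auto simp: k_def)
  have tk: "t + \<delta> = d + a * k + \<rho>"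
    using d t k(2) by (simp add: algebra_simps)
  have base: "nat (\<lfloor>real t / real a\<rfloor> - \<lceil>real d / real a\<rceil>) = k - 1"
    "nat (\<lfloor>real t / real a\<rfloor> - \<lfloor>real d / real a\<rfloor>) = k"
    using k by (simp_all add: flt fld cld)
  have eqs: "int a * int (t div a) = int t - int \<rho>" "int a * int (d div a) = int d - int \<delta>"
    using arg_cong[OF t, of int] arg_cong[OF d, of int] by simp_all
  have expo: "int a * \<lfloor>real t / real a\<rfloor> - int a * \<lfloor>real d / real a\<rfloor> + int d + 1 - int t = int \<delta> + 1 - int \<rho>"
    "int a - int a * \<lfloor>real t / real a\<rfloor> + int a * \<lfloor>real d / real a\<rfloor> - int d - 1 + int t =
      int a - (int \<delta> + 1 - int \<rho>)"
    unfolding flt fld using eqs by linarith+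
  show ?thesis
    unfolding base expo F_def[symmetric]
  proof (cases "\<rho> \<le> \<delta> + 1")
    case True
    define e where "e = \<delta> + 1 - \<rho>"
    have e: "int \<delta> + 1 - int \<rho> = int e" using True by (simp add: e_def)
    have "0 < \<rho>" using at a1 by (auto simp: \<rho>_def dvd_eq_mod_eq_0)
    then have ea: "e < a" using \<delta> by (simp add: e_def)
    have "a * k = e * (k - 1) + (a - e) * k + e"
    proof -
      obtain k' where "k = Suc k'" using k(1) by (cases k) auto
      moreover obtain b where "a = e + b" using ea le_Suc_ex less_imp_le by blast
      ultimately show ?thesis by (simp add: algebra_simps)
    qed
    then have t': "t = Suc d + (e * (k - 1) + (a - e) * k)"
      using tk True by (simp add: e_def)
    obtain m' A' where A': "indiscreet t f d x m' A'"
      "(k - 1 choose F) ^ e * (k choose F) ^ (a - e) \<le> ?card m' A'"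
      by (rule single_groups_strategy[OF x f ad at t']) (use ea k in auto)
    then have "(k - 1 choose F) ^ e * (k choose F) ^ (a - e) \<le> ?card m A"
      using best le_trans by blast
    then have "real ((k - 1 choose F) ^ e * (k choose F) ^ (a - e)) \<le> real (?card m A)"
      by (simp only: of_nat_le_iff)
    moreover have "int a - int e = int (a - e)" using ea by simp
    ultimately show "real (k - 1 choose F) powi (int \<delta> + 1 - int \<rho>) *
        real (k choose F) powi (int a - (int \<delta> + 1 - int \<rho>)) \<le> real (?card m A)"
      unfolding e by (simp only: power_int_of_nat of_nat_mult of_nat_power)
  next
    case False
    \<comment> \<open>Of the \<open>j + 1\<close> coins beyond groups of uniform size \<open>k\<close>, one makes the base group, which must
      not be merged; the other \<open>j\<close> are used in pairs, up to parity.\<close>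
    define j p \<epsilon> where "j = \<rho> - \<delta> - 1" and "p = j div 2" and "\<epsilon> = j mod 2"
    have j: "j = 2 * p + \<epsilon>" "\<epsilon> \<le> 1" by (auto simp: p_def \<epsilon>_def)
    have ja: "j + 2 < a" "int \<delta> + 1 - int \<rho> = - int j" "\<rho> = \<delta> + 1 + j"
      using False \<rho> \<delta> by (auto simp: j_def)
    define e' where "e' = a - Suc \<epsilon> - 2 * p"
    have a: "Suc \<epsilon> + e' + 2 * p = a" and e': "0 < e'" using ja j by (auto simp: e'_def)
    have "t = d + (a * k + j + 1)" using tk ja(3) by simp
    also have "a * k + j + 1 = Suc \<epsilon> * Suc k + e' * k + p * (2 * Suc k)"
      unfolding j(1) a[symmetric] by (simp add: algebra_simps)
    finally have t': "t = d + (Suc \<epsilon> * Suc k + e' * k + p * (2 * Suc k))" .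
    have td: "t mod a \<noteq> d mod a" using False by (simp add: \<rho>_def \<delta>_def)
    obtain m' A' where A': "indiscreet t f d x m' A'"
      "(Suc k choose F) ^ Suc \<epsilon> * (k choose F) ^ e' * (2 * Suc k choose (2 * F)) ^ p \<le> ?card m' A'"
      by (rule double_groups_strategy[OF x f ad at td t' a]) (use e' k in auto)
    let ?c = "real (k choose F)" and ?b = "real (k - 1 choose F)"
    let ?q = "real k / (real k - real F)"
    have "?c ^ a * ?q ^ j \<le> real (?card m' A')"
      using double_groups_count_ge[OF k(1) j(2), of e' p] A'(2) unfolding a j(1)[symmetric]
      by (meson of_nat_le_iff order_trans)
    also have "\<dots> \<le> real (?card m A)" using best[OF A'(1)] by simp
    finally have bound: "?c ^ a * ?q ^ j \<le> real (?card m A)" .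
    have b0: "?b \<noteq> 0" using k(1) by simp
    have "?c = ?b * ?q"
      using Suc_choose_ratio[of F "k - 1"] k(1) by (simp add: of_nat_diff)
    then have "?q ^ j = ?c ^ j / ?b ^ j"
      using b0 by (simp add: power_mult_distrib flip: power_divide)
    moreover have "int a - - int j = int (a + j)" by simp
    ultimately show "?b powi (int \<delta> + 1 - int \<rho>) * ?c powi (int a - (int \<delta> + 1 - int \<rho>))
        \<le> real (?card m A)"
      unfolding ja(2) using bound
      by (simp only: power_int_minus power_int_of_nat power_add) (simp add: field_simps)
  qed
qed

end
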